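(* Let $\mathcal{T}$ be a theory over a one-sorted first-order signature $\Sigma$. If $\mu(\mathcal{T},\phi)$ is (well-defined and) positive for every $\mathcal{T}$-satisfiable quantifier-free $\Sigma$-formula $\phi$, then $\mathcal{T}$ is stably infinite and has the finite model property.
   Context: A signature has countably many function and predicate symbols (with equality). Interpretations have non-empty domains and assign values to all variables; a theory is the class of all interpretations satisfying a given set of sentences. For a quantifier-free formula $\phi$, $\mathrm{Spec}(\mathcal{T},\phi)$ is the set of finite cardinalities of domains of $\mathcal{T}$-interpretations satisfying $\phi$, $\mathrm{Spec}_n(\mathcal{T},\phi)=\mathrm{Spec}(\mathcal{T},\phi)\cap\{1,\dots,n\}$, and $\mu(\mathcal{T},\phi)=\lim_{n\to\infty}|\mathrm{Spec}_n(\mathcal{T},\phi)|/n$ when the limit exists. $\mathcal{T}$ is stably infinite if every $\mathcal{T}$-satisfiable quantifier-free formula is satisfied by a $\mathcal{T}$-interpretation with infinite domain; it has the finite model property if every $\mathcal{T}$-satisfiable quantifier-free formula is satisfied by a $\mathcal{T}$-interpretation with finite domain. *)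

theory Defs
  imports Complex_Main "HOL-Library.Countable_Set"
begin

record ('f, 'p) signature =
  funs :: "'f set"
  preds :: "'p set"
  farity :: "'f \<Rightarrow> nat"
  parity :: "'p \<Rightarrow> nat"

definition countable_signature :: "('f, 'p) signature \<Rightarrow> bool" where
  "countable_signature \<Sigma> \<longleftrightarrow> countable (funs \<Sigma>) \<and> countable (preds \<Sigma>)"

datatype 'f tm = Var nat | Fn 'f "'f tm list"

datatype ('f, 'p) fm =
    Eq "'f tm" "'f tm"
  | Pred 'p "'f tm list"
  | Neg "('f, 'p) fm"
  | And "('f, 'p) fm" "('f, 'p) fm"
  | Or "('f, 'p) fm" "('f, 'p) fm"
  | Imp "('f, 'p) fm" "('f, 'p) fm"
  | All nat "('f, 'p) fm"
  | Ex nat "('f, 'p) fm"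

fun tm_over :: "('f, 'p) signature \<Rightarrow> 'f tm \<Rightarrow> bool" where
  "tm_over \<Sigma> (Var x) \<longleftrightarrow> True"
| "tm_over \<Sigma> (Fn f ts) \<longleftrightarrow>
     f \<in> funs \<Sigma> \<and> length ts = farity \<Sigma> f \<and> (\<forall>t \<in> set ts. tm_over \<Sigma> t)"

fun fm_over :: "('f, 'p) signature \<Rightarrow> ('f, 'p) fm \<Rightarrow> bool" where
  "fm_over \<Sigma> (Eq s t) \<longleftrightarrow> tm_over \<Sigma> s \<and> tm_over \<Sigma> t"
| "fm_over \<Sigma> (Pred p ts) \<longleftrightarrow>
     p \<in> preds \<Sigma> \<and> length ts = parity \<Sigma> p \<and> (\<forall>t \<in> set ts. tm_over \<Sigma> t)"
| "fm_over \<Sigma> (Neg \<phi>) \<longleftrightarrow> fm_over \<Sigma> \<phi>"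
| "fm_over \<Sigma> (And \<phi> \<psi>) \<longleftrightarrow> fm_over \<Sigma> \<phi> \<and> fm_over \<Sigma> \<psi>"
| "fm_over \<Sigma> (Or \<phi> \<psi>) \<longleftrightarrow> fm_over \<Sigma> \<phi> \<and> fm_over \<Sigma> \<psi>"
| "fm_over \<Sigma> (Imp \<phi> \<psi>) \<longleftrightarrow> fm_over \<Sigma> \<phi> \<and> fm_over \<Sigma> \<psi>"
| "fm_over \<Sigma> (All x \<phi>) \<longleftrightarrow> fm_over \<Sigma> \<phi>"
| "fm_over \<Sigma> (Ex x \<phi>) \<longleftrightarrow> fm_over \<Sigma> \<phi>"

fun tm_vars :: "'f tm \<Rightarrow> nat set" where
  "tm_vars (Var x) = {x}"
| "tm_vars (Fn f ts) = (\<Union>t \<in> set ts. tm_vars t)"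

fun free_vars :: "('f, 'p) fm \<Rightarrow> nat set" where
  "free_vars (Eq s t) = tm_vars s \<union> tm_vars t"
| "free_vars (Pred p ts) = (\<Union>t \<in> set ts. tm_vars t)"
| "free_vars (Neg \<phi>) = free_vars \<phi>"
| "free_vars (And \<phi> \<psi>) = free_vars \<phi> \<union> free_vars \<psi>"
| "free_vars (Or \<phi> \<psi>) = free_vars \<phi> \<union> free_vars \<psi>"
| "free_vars (Imp \<phi> \<psi>) = free_vars \<phi> \<union> free_vars \<psi>"
| "free_vars (All x \<phi>) = free_vars \<phi> - {x}"
| "free_vars (Ex x \<phi>) = free_vars \<phi> - {x}"

fun quantifier_free :: "('f, 'p) fm \<Rightarrow> bool" where
  "quantifier_free (Eq s t) \<longleftrightarrow> True"
| "quantifier_free (Pred p ts) \<longleftrightarrow> True"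
| "quantifier_free (Neg \<phi>) \<longleftrightarrow> quantifier_free \<phi>"
| "quantifier_free (And \<phi> \<psi>) \<longleftrightarrow> quantifier_free \<phi> \<and> quantifier_free \<psi>"
| "quantifier_free (Or \<phi> \<psi>) \<longleftrightarrow> quantifier_free \<phi> \<and> quantifier_free \<psi>"
| "quantifier_free (Imp \<phi> \<psi>) \<longleftrightarrow> quantifier_free \<phi> \<and> quantifier_free \<psi>"
| "quantifier_free (All x \<phi>) \<longleftrightarrow> False"
| "quantifier_free (Ex x \<phi>) \<longleftrightarrow> False"

definition qf_formula :: "('f, 'p) signature \<Rightarrow> ('f, 'p) fm \<Rightarrow> bool" where
  "qf_formula \<Sigma> \<phi> \<longleftrightarrow> fm_over \<Sigma> \<phi> \<and> quantifier_free \<phi>"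

definition sentence :: "('f, 'p) signature \<Rightarrow> ('f, 'p) fm \<Rightarrow> bool" where
  "sentence \<Sigma> \<phi> \<longleftrightarrow> fm_over \<Sigma> \<phi> \<and> free_vars \<phi> = {}"

text \<open>
  Domains are subsets of a type \<open>'u\<close>. As signatures are countable, downward
  Loewenheim-Skolem makes satisfiability, spectra and the model properties below independent
  of the choice of \<open>'u\<close>, provided it is infinite. Values of \<open>fun_int\<close> and \<open>pred_int\<close> at symbols
  outside the signature, or at argument lists of the wrong length or with entries outside the
  domain, are irrelevant junk. An interpretation includes an assignment to the variables.
\<close>

record ('f, 'p, 'u) interp =
  domain :: "'u set"
  fun_int :: "'f \<Rightarrow> 'u list \<Rightarrow> 'u"
  pred_int :: "'p \<Rightarrow> 'u list \<Rightarrow> bool"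
  assignment :: "nat \<Rightarrow> 'u"

definition is_interp :: "('f, 'p) signature \<Rightarrow> ('f, 'p, 'u) interp \<Rightarrow> bool" where
  "is_interp \<Sigma> \<A> \<longleftrightarrow>
     domain \<A> \<noteq> {} \<and>
     (\<forall>f \<in> funs \<Sigma>. \<forall>as. length as = farity \<Sigma> f \<and> set as \<subseteq> domain \<A> \<longrightarrow>
        fun_int \<A> f as \<in> domain \<A>) \<and>
     (\<forall>x. assignment \<A> x \<in> domain \<A>)"

fun tm_val :: "('f, 'p, 'u) interp \<Rightarrow> 'f tm \<Rightarrow> 'u" where
  "tm_val \<A> (Var x) = assignment \<A> x"
| "tm_val \<A> (Fn f ts) = fun_int \<A> f (map (tm_val \<A>) ts)"

fun sat :: "('f, 'p, 'u) interp \<Rightarrow> ('f, 'p) fm \<Rightarrow> bool" where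
  "sat \<A> (Eq s t) \<longleftrightarrow> tm_val \<A> s = tm_val \<A> t"
| "sat \<A> (Pred p ts) \<longleftrightarrow> pred_int \<A> p (map (tm_val \<A>) ts)"
| "sat \<A> (Neg \<phi>) \<longleftrightarrow> \<not> sat \<A> \<phi>"
| "sat \<A> (And \<phi> \<psi>) \<longleftrightarrow> sat \<A> \<phi> \<and> sat \<A> \<psi>"
| "sat \<A> (Or \<phi> \<psi>) \<longleftrightarrow> sat \<A> \<phi> \<or> sat \<A> \<psi>"
| "sat \<A> (Imp \<phi> \<psi>) \<longleftrightarrow> (sat \<A> \<phi> \<longrightarrow> sat \<A> \<psi>)"
| "sat \<A> (All x \<phi>) \<longleftrightarrow>
     (\<forall>a \<in> domain \<A>. sat (\<A>\<lparr>assignment := (assignment \<A>)(x := a)\<rparr>) \<phi>)"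
| "sat \<A> (Ex x \<phi>) \<longleftrightarrow>
     (\<exists>a \<in> domain \<A>. sat (\<A>\<lparr>assignment := (assignment \<A>)(x := a)\<rparr>) \<phi>)"

definition is_theory ::
    "('f, 'p) signature \<Rightarrow> ('f, 'p, 'u) interp set \<Rightarrow> bool" where
  "is_theory \<Sigma> T \<longleftrightarrow>
     (\<exists>Ax. (\<forall>\<psi> \<in> Ax. sentence \<Sigma> \<psi>) \<and>
           T = {\<A>. is_interp \<Sigma> \<A> \<and> (\<forall>\<psi> \<in> Ax. sat \<A> \<psi>)})"

definition satisfiable_in ::
    "('f, 'p, 'u) interp set \<Rightarrow> ('f, 'p) fm \<Rightarrow> bool" where
  "satisfiable_in T \<phi> \<longleftrightarrow> (\<exists>\<A> \<in> T. sat \<A> \<phi>)"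

definition Spec :: "('f, 'p, 'u) interp set \<Rightarrow> ('f, 'p) fm \<Rightarrow> nat set" where
  "Spec T \<phi> = {card (domain \<A>) | \<A>. \<A> \<in> T \<and> finite (domain \<A>) \<and> sat \<A> \<phi>}"

definition Spec_upto ::
    "('f, 'p, 'u) interp set \<Rightarrow> ('f, 'p) fm \<Rightarrow> nat \<Rightarrow> nat set" where
  "Spec_upto T \<phi> n = Spec T \<phi> \<inter> {1..n}"

definition density_seq ::
    "('f, 'p, 'u) interp set \<Rightarrow> ('f, 'p) fm \<Rightarrow> nat \<Rightarrow> real" where
  "density_seq T \<phi> n = real (card (Spec_upto T \<phi> n)) / real n"

definition \<mu>_defined :: "('f, 'p, 'u) interp set \<Rightarrow> ('f, 'p) fm \<Rightarrow> bool" where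
  "\<mu>_defined T \<phi> \<longleftrightarrow> convergent (density_seq T \<phi>)"

text \<open>Only meaningful when \<open>\<mu>_defined T \<phi>\<close> holds.\<close>

definition \<mu> :: "('f, 'p, 'u) interp set \<Rightarrow> ('f, 'p) fm \<Rightarrow> real" where
  "\<mu> T \<phi> = lim (density_seq T \<phi>)"

definition stably_infinite ::
    "('f, 'p) signature \<Rightarrow> ('f, 'p, 'u) interp set \<Rightarrow> bool" where
  "stably_infinite \<Sigma> T \<longleftrightarrow>
     (\<forall>\<phi>. qf_formula \<Sigma> \<phi> \<and> satisfiable_in T \<phi> \<longrightarrow>
        (\<exists>\<A> \<in> T. infinite (domain \<A>) \<and> sat \<A> \<phi>))"

definition finite_model_property ::
    "('f, 'p) signature \<Rightarrow> ('f, 'p, 'u) interp set \<Rightarrow> bool" where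
  "finite_model_property \<Sigma> T \<longleftrightarrow>
     (\<forall>\<phi>. qf_formula \<Sigma> \<phi> \<and> satisfiable_in T \<phi> \<longrightarrow>
        (\<exists>\<A> \<in> T. finite (domain \<A>) \<and> sat \<A> \<phi>))"

end

theory Submission
  imports Defs
begin

text \<open>
  Positive density forces the spectrum of \<open>\<phi>\<close> to be infinite, which gives the finite model
  property and, for each \<open>n\<close>, a finite model \<open>A n\<close> of \<open>\<phi>\<close> with more than \<open>n\<close> elements.
  An infinite model is found inside an ultraproduct of the \<open>A n\<close>. It has to live on the given
  type \<open>'u\<close>, which may be countable, so instead of the full product one takes a countable
  set \<open>S\<close> of choice functions that is closed under Skolem functions computed coordinatewise.
  This closure is all that the proof of Los's theorem needs, and \<open>S\<close> modulo the ultrafilter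
  embeds into \<open>'u\<close>.
\<close>

section \<open>Ultrafilters\<close>

text \<open>Smaller filters are finer, so an ultrafilter is a minimal proper filter, and Zorn's
  lemma is used with the order reversed. A minimal \<open>U\<close> decides every \<open>P\<close>:
  adjoining \<open>P\<close> to \<open>U\<close> either destroys properness or changes
  nothing.\<close>

lemma ex_ultrafilter_le:
  fixes F :: "'a filter"
  assumes "F \<noteq> bot"
  obtains U where "U \<le> F" "U \<noteq> bot"
    "\<And>P. \<not> eventually P U \<Longrightarrow> eventually (\<lambda>x. \<not> P x) U"
proof -
  let ?A = "{G. G \<noteq> bot \<and> G \<le> F}" and ?P = "\<lambda>G H :: 'a filter. H \<le> G"
  have "\<exists>m\<in>?A. \<forall>a\<in>?A. ?P m a \<longrightarrow> a = m"
  proof (rule predicate_Zorn)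
    show "partial_order_on ?A (relation_of ?P ?A)"
      by (rule partial_order_on_relation_ofI) auto
  next
    fix C assume C: "C \<in> Chains (relation_of ?P ?A)"
    show "\<exists>u\<in>?A. \<forall>a\<in>C. ?P a u"
    proof (cases "C = {}")
      case True
      then show ?thesis using assms by auto
    next
      case False
      have CA: "C \<subseteq> ?A" and lin: "\<And>G H. G \<in> C \<Longrightarrow> H \<in> C \<Longrightarrow> G \<le> H \<or> H \<le> G"
        using C by (auto simp: Chains_def relation_of_def)
      \<comment> \<open>The members of a chain form a base of its infimum, so properness passes to
        \<open>Inf C\<close>.\<close>
      have "eventually P (Inf C) \<longleftrightarrow> (\<exists>G\<in>C. eventually P G)" for P
        using False lin by (intro eventually_Inf_base) (metis le_inf_iff order_refl)+
      then have "Inf C \<noteq> bot"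
        using CA by (auto simp: trivial_limit_def)
      moreover have "Inf C \<le> F"
        using False CA by (auto intro: Inf_lower2)
      ultimately show ?thesis
        by (auto intro: Inf_lower)
    qed
  qed
  then obtain U where U: "U \<noteq> bot" "U \<le> F"
    and min: "\<And>G. G \<noteq> bot \<Longrightarrow> G \<le> U \<Longrightarrow> G = U"
    by (auto intro: order_trans)
  have "eventually (\<lambda>x. \<not> P x) U" if "\<not> eventually P U" for P
  proof (rule ccontr)
    assume "\<not> eventually (\<lambda>x. \<not> P x) U"
    then have "inf U (principal {x. P x}) \<noteq> bot"
      by (simp add: trivial_limit_def eventually_inf_principal)
    then have "inf U (principal {x. P x}) = U"
      by (intro min) auto
    then have "eventually P U \<longleftrightarrow> eventually P (inf U (principal {x. P x}))"
      by (rule arg_cong[OF sym])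
    then show False using that by (simp add: eventually_inf_principal)
  qed
  with U that show ?thesis by blast
qed

section \<open>Countability of the language\<close>

instance tm :: (countable) countable
  by countable_datatype

instance fm :: (countable, countable) countable
  by countable_datatype

lemma set_tm_over: "tm_over \<Sigma> t \<Longrightarrow> set_tm t \<subseteq> funs \<Sigma>"
  by (induction t) auto

lemma set_fm_over: "fm_over \<Sigma> \<psi> \<Longrightarrow> set1_fm \<psi> \<subseteq> funs \<Sigma> \<and> set2_fm \<psi> \<subseteq> preds \<Sigma>"
  by (induction \<psi>) (use set_tm_over in fastforce)+

text \<open>The types \<open>'f\<close> and \<open>'p\<close> may be uncountable, so the symbols are
  relabelled by natural numbers. A relabelling that is injective on the symbols of the signature is
  injective on the formulas over it.\<close>

lemma countable_fm_over:
  assumes "countable_signature \<Sigma>"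
  shows "countable {\<psi>. fm_over \<Sigma> \<psi>}"
proof (rule countable_image_inj_on)
  let ?c = "map_fm (to_nat_on (funs \<Sigma>)) (to_nat_on (preds \<Sigma>))"
  show "countable (?c ` {\<psi>. fm_over \<Sigma> \<psi>})" by simp
  have inj: "inj_on (to_nat_on (funs \<Sigma>)) (funs \<Sigma>)" "inj_on (to_nat_on (preds \<Sigma>)) (preds \<Sigma>)"
    using assms by (auto simp: countable_signature_def)
  show "inj_on ?c {\<psi>. fm_over \<Sigma> \<psi>}"
  proof (rule inj_onI)
    fix \<psi> \<chi> assume over: "\<psi> \<in> {\<psi>. fm_over \<Sigma> \<psi>}" "\<chi> \<in> {\<psi>. fm_over \<Sigma> \<psi>}" and "?c \<psi> = ?c \<chi>"
    then show "\<psi> = \<chi>"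
      using set_fm_over[of \<Sigma> \<psi>] set_fm_over[of \<Sigma> \<chi>]
      by (elim fm.inj_map_strong[rotated 2]) (blast dest: inj_onD[OF inj(1)] inj_onD[OF inj(2)])+
  qed
qed

text \<open>The closure is the set of values of terms whose function symbols are the operations.\<close>

lemma countable_closure_under_operations:
  fixes op :: "nat \<Rightarrow> 'a list \<Rightarrow> 'a"
  assumes "countable B" "B \<subseteq> D" "B \<noteq> {}"
    and "\<And>k xs. set xs \<subseteq> D \<Longrightarrow> op k xs \<in> D"
  obtains S where "countable S" "B \<subseteq> S" "S \<subseteq> D" "\<And>k xs. set xs \<subseteq> S \<Longrightarrow> op k xs \<in> S"
proof -
  \<comment> \<open>The variables enumerate \<open>B\<close>. Terms carry no arity restriction, so
    every operation applies to lists of every length.\<close>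
  define M :: "(nat, unit, 'a) interp" where
    "M = \<lparr>domain = D, fun_int = op, pred_int = (\<lambda>_ _. True), assignment = from_nat_into B\<rparr>"
  let ?S = "range (tm_val M)"
  have "tm_val M t \<in> D" for t
  proof (induction t)
    case (Var x)
    then show ?case
      using assms by (auto simp: M_def intro: from_nat_into)
  next
    case (Fn f ts)
    then show ?case
      using assms(4)[of "map (tm_val M) ts" f] by (auto simp: M_def)
  qed
  then have "?S \<subseteq> D" by auto
  moreover have "B \<subseteq> ?S"
  proof
    fix b assume "b \<in> B"
    then obtain n where "from_nat_into B n = b"
      using assms(1) from_nat_into_surj by metis
    then have "tm_val M (Var n) = b" by (simp add: M_def)
    then show "b \<in> ?S" by blast
  qed
  moreover have "op k xs \<in> ?S" if xs: "set xs \<subseteq> ?S" for k xs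
  proof -
    obtain ts where "xs = map (tm_val M) ts"
      using xs ex_map_conv[of xs "tm_val M"] by blast
    then have "op k xs = tm_val M (Fn k ts)" by (simp add: M_def)
    then show ?thesis by blast
  qed
  ultimately show ?thesis
    by (intro that[of ?S]) auto
qed

section \<open>Semantics\<close>

lemma finite_tm_vars [simp]: "finite (tm_vars t)"
  by (induction t) auto

lemma finite_free_vars [simp]: "finite (free_vars \<psi>)"
  by (induction \<psi>) auto

lemma tm_val_cong_assignment:
  assumes "\<And>x. x \<in> tm_vars t \<Longrightarrow> \<alpha> x = \<beta> x"
  shows "tm_val (M\<lparr>assignment := \<alpha>\<rparr>) t = tm_val (M\<lparr>assignment := \<beta>\<rparr>) t"
  using assms
proof (induction t)
  case (Fn f ts)
  then have "map (tm_val (M\<lparr>assignment := \<alpha>\<rparr>)) ts = map (tm_val (M\<lparr>assignment := \<beta>\<rparr>)) ts"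
    by (intro map_cong refl Fn.IH) auto
  then show ?case by (simp del: map_eq_conv)
qed simp

lemma sat_cong_assignment:
  assumes "\<And>x. x \<in> free_vars \<psi> \<Longrightarrow> \<alpha> x = \<beta> x"
  shows "sat (M\<lparr>assignment := \<alpha>\<rparr>) \<psi> \<longleftrightarrow> sat (M\<lparr>assignment := \<beta>\<rparr>) \<psi>"
  using assms
proof (induction \<psi> arbitrary: \<alpha> \<beta>)
  case (Eq s t)
  then show ?case
    using tm_val_cong_assignment[of s \<alpha> \<beta> M] tm_val_cong_assignment[of t \<alpha> \<beta> M] by simp
next
  case (Pred p ts)
  then have "map (tm_val (M\<lparr>assignment := \<alpha>\<rparr>)) ts = map (tm_val (M\<lparr>assignment := \<beta>\<rparr>)) ts"
    by (intro map_cong refl tm_val_cong_assignment) auto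
  then show ?case by (simp del: map_eq_conv)
next
  case (All x \<psi>)
  have "sat (M\<lparr>assignment := \<alpha>(x := a)\<rparr>) \<psi> \<longleftrightarrow> sat (M\<lparr>assignment := \<beta>(x := a)\<rparr>) \<psi>" for a
    by (intro All.IH) (use All.prems in auto)
  then show ?case by simp
next
  case (Ex x \<psi>)
  have "sat (M\<lparr>assignment := \<alpha>(x := a)\<rparr>) \<psi> \<longleftrightarrow> sat (M\<lparr>assignment := \<beta>(x := a)\<rparr>) \<psi>" for a
    by (intro Ex.IH) (use Ex.prems in auto)
  then show ?case by simp
next
  case (Neg \<psi>)
  have "sat (M\<lparr>assignment := \<alpha>\<rparr>) \<psi> \<longleftrightarrow> sat (M\<lparr>assignment := \<beta>\<rparr>) \<psi>"
    by (intro Neg.IH) (use Neg.prems in auto)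
  then show ?case by simp
next
  case (And \<psi>1 \<psi>2)
  have "sat (M\<lparr>assignment := \<alpha>\<rparr>) \<psi>1 \<longleftrightarrow> sat (M\<lparr>assignment := \<beta>\<rparr>) \<psi>1"
    by (intro And.IH) (use And.prems in auto)
  moreover have "sat (M\<lparr>assignment := \<alpha>\<rparr>) \<psi>2 \<longleftrightarrow> sat (M\<lparr>assignment := \<beta>\<rparr>) \<psi>2"
    by (intro And.IH) (use And.prems in auto)
  ultimately show ?case by simp
next
  case (Or \<psi>1 \<psi>2)
  have "sat (M\<lparr>assignment := \<alpha>\<rparr>) \<psi>1 \<longleftrightarrow> sat (M\<lparr>assignment := \<beta>\<rparr>) \<psi>1"
    by (intro Or.IH) (use Or.prems in auto)
  moreover have "sat (M\<lparr>assignment := \<alpha>\<rparr>) \<psi>2 \<longleftrightarrow> sat (M\<lparr>assignment := \<beta>\<rparr>) \<psi>2"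
    by (intro Or.IH) (use Or.prems in auto)
  ultimately show ?case by simp
next
  case (Imp \<psi>1 \<psi>2)
  have "sat (M\<lparr>assignment := \<alpha>\<rparr>) \<psi>1 \<longleftrightarrow> sat (M\<lparr>assignment := \<beta>\<rparr>) \<psi>1"
    by (intro Imp.IH) (use Imp.prems in auto)
  moreover have "sat (M\<lparr>assignment := \<alpha>\<rparr>) \<psi>2 \<longleftrightarrow> sat (M\<lparr>assignment := \<beta>\<rparr>) \<psi>2"
    by (intro Imp.IH) (use Imp.prems in auto)
  ultimately show ?case by simp
qed

section \<open>Countable Skolem hulls in a product\<close>

text \<open>Choosing witnesses separately in each coordinate turns a list of choice functions into a
  new one. There are countably many pairs \<open>(x, \<psi>)\<close>, and each \<psi> has finitely
  many free variables, so countably many operations on finite lists serve all assignments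
  \<sigma>.\<close>

lemma countable_skolem_hull:
  fixes A :: "nat \<Rightarrow> ('f, 'p, 'u) interp" and B :: "(nat \<Rightarrow> 'u) set"
  assumes "countable_signature \<Sigma>"
    and nonempty: "\<And>n. domain (A n) \<noteq> {}"
    and B: "countable B" "B \<noteq> {}" "\<And>g n. g \<in> B \<Longrightarrow> g n \<in> domain (A n)"
  obtains S where "countable S" "B \<subseteq> S" "\<And>g n. g \<in> S \<Longrightarrow> g n \<in> domain (A n)"
    "\<And>\<psi> x \<sigma>. fm_over \<Sigma> \<psi> \<Longrightarrow> range \<sigma> \<subseteq> S \<Longrightarrow>
       \<exists>g\<in>S. \<forall>n. (\<exists>a\<in>domain (A n). sat ((A n)\<lparr>assignment := (\<lambda>y. \<sigma> y n)(x := a)\<rparr>) \<psi>)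
         \<longrightarrow> sat ((A n)\<lparr>assignment := (\<lambda>y. \<sigma> y n)(x := g n)\<rparr>) \<psi>"
proof -
  define D where "D = {g. \<forall>n. g n \<in> domain (A n)}"
  \<comment> \<open>Parameters are passed as a list; \<open>xs ! y\<close> past its end is
    unspecified and will have to be irrelevant.\<close>
  define good where "good x \<psi> xs n a \<longleftrightarrow> a \<in> domain (A n) \<and>
      sat ((A n)\<lparr>assignment := (\<lambda>y. (xs ! y) n)(x := a)\<rparr>) \<psi>" for x \<psi> xs n a
  \<comment> \<open>Where no witness exists, the choice still falls into the domain, which keeps the
    operations inside \<open>D\<close>.\<close>
  define sk where "sk x \<psi> xs n = (SOME a. a \<in> domain (A n) \<and>
      ((\<exists>b. good x \<psi> xs n b) \<longrightarrow> good x \<psi> xs n a))" for x \<psi> xs n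
  have sk: "sk x \<psi> xs n \<in> domain (A n) \<and>
      ((\<exists>b. good x \<psi> xs n b) \<longrightarrow> good x \<psi> xs n (sk x \<psi> xs n))" for x \<psi> xs n
    unfolding sk_def
  proof (rule someI_ex)
    show "\<exists>a. a \<in> domain (A n) \<and> ((\<exists>b. good x \<psi> xs n b) \<longrightarrow> good x \<psi> xs n a)"
      using nonempty[of n] unfolding good_def by blast
  qed
  let ?F = "(UNIV :: nat set) \<times> {\<psi>. fm_over \<Sigma> \<psi>}"
  have F: "countable ?F"
    using countable_fm_over[OF assms(1)] by simp
  define op where "op k xs = (case from_nat_into ?F k of (x, \<psi>) \<Rightarrow> sk x \<psi> xs)" for k xs
  have "op k xs \<in> D" for k xs
    using sk by (auto simp: op_def D_def split: prod.split)
  moreover have "B \<subseteq> D" using B by (auto simp: D_def)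
  ultimately obtain S where S: "countable S" "B \<subseteq> S" "S \<subseteq> D"
      "\<And>k xs. set xs \<subseteq> S \<Longrightarrow> op k xs \<in> S"
    using countable_closure_under_operations[of B D op] B by metis
  have "\<exists>g\<in>S. \<forall>n. (\<exists>a\<in>domain (A n). sat ((A n)\<lparr>assignment := (\<lambda>y. \<sigma> y n)(x := a)\<rparr>) \<psi>)
         \<longrightarrow> sat ((A n)\<lparr>assignment := (\<lambda>y. \<sigma> y n)(x := g n)\<rparr>) \<psi>"
    if \<psi>: "fm_over \<Sigma> \<psi>" and \<sigma>: "range \<sigma> \<subseteq> S" for \<psi> x \<sigma>
  proof -
    obtain m where m: "\<And>y. y \<in> free_vars \<psi> \<Longrightarrow> y < m"
      using finite_nat_set_iff_bounded[of "free_vars \<psi>"] by auto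
    \<comment> \<open>The list is long enough to cover all free variables of \<psi>, so it
      determines the same truth values as \<sigma>.\<close>
    define xs where "xs = map \<sigma> [0..<m]"
    have good: "good x \<psi> xs n a \<longleftrightarrow> a \<in> domain (A n) \<and>
        sat ((A n)\<lparr>assignment := (\<lambda>y. \<sigma> y n)(x := a)\<rparr>) \<psi>" for n a
      unfolding good_def by (intro conj_cong refl sat_cong_assignment) (auto simp: xs_def dest: m)
    obtain k where "from_nat_into ?F k = (x, \<psi>)"
      using from_nat_into_surj[OF F, of "(x, \<psi>)"] \<psi> by auto
    then have "sk x \<psi> xs = op k xs" by (simp add: op_def)
    moreover have "op k xs \<in> S"
      using \<sigma> by (intro S(4)) (auto simp: xs_def)
    ultimately have "sk x \<psi> xs \<in> S" by simp
    then show ?thesis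
      using sk[of x \<psi> xs] by (intro bexI[of _ "sk x \<psi> xs"]) (auto simp: good)
  qed
  then show ?thesis
    using S(3) by (intro that[OF S(1,2)]) (auto simp: D_def)
qed

section \<open>Los's theorem\<close>

text \<open>\<open>S\<close> stands in for the full product and \<open>h\<close> for the quotient
  map, with codes in \<open>'v\<close> instead of equivalence classes. \<open>S_witness\<close>
  supplies what the full product would get from the axiom of choice.\<close>

locale skolem_ultraproduct =
  fixes \<Sigma> :: "('f, 'p) signature" and A :: "nat \<Rightarrow> ('f, 'p, 'u) interp"
    and U :: "nat filter" and S :: "(nat \<Rightarrow> 'u) set" and h :: "(nat \<Rightarrow> 'u) \<Rightarrow> 'v"
  assumes interp: "\<And>n. is_interp \<Sigma> (A n)"
    and U_proper: "U \<noteq> bot"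
    and U_ultra: "\<And>P. \<not> eventually P U \<Longrightarrow> eventually (\<lambda>n. \<not> P n) U"
    and S_domain: "\<And>g n. g \<in> S \<Longrightarrow> g n \<in> domain (A n)"
    and S_assignment: "\<And>x. (\<lambda>n. assignment (A n) x) \<in> S"
    and S_witness: "\<And>\<psi> x \<sigma>. fm_over \<Sigma> \<psi> \<Longrightarrow> range \<sigma> \<subseteq> S \<Longrightarrow>
       \<exists>g\<in>S. \<forall>n. (\<exists>a\<in>domain (A n). sat ((A n)\<lparr>assignment := (\<lambda>y. \<sigma> y n)(x := a)\<rparr>) \<psi>)
         \<longrightarrow> sat ((A n)\<lparr>assignment := (\<lambda>y. \<sigma> y n)(x := g n)\<rparr>) \<psi>"
    and h_eq_iff: "\<And>g g'. g \<in> S \<Longrightarrow> g' \<in> S \<Longrightarrow> h g = h g' \<longleftrightarrow> eventually (\<lambda>n. g n = g' n) U"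
begin

definition rep :: "'v \<Rightarrow> nat \<Rightarrow> 'u" where
  "rep = inv_into S h"

text \<open>Symbols act on the representatives chosen by \<open>rep\<close>, so no well-definedness
  proof has to come first. Independence of the representatives follows later from
  \<open>eventually_map_rep_h\<close>.\<close>

definition model :: "('f, 'p, 'v) interp" where
  "model = \<lparr>domain = h ` S,
     fun_int = (\<lambda>f us. h (\<lambda>n. fun_int (A n) f (map (\<lambda>u. rep u n) us))),
     pred_int = (\<lambda>p us. eventually (\<lambda>n. pred_int (A n) p (map (\<lambda>u. rep u n) us)) U),
     assignment = (\<lambda>x. h (\<lambda>n. assignment (A n) x))\<rparr>"

abbreviation coord :: "(nat \<Rightarrow> nat \<Rightarrow> 'u) \<Rightarrow> nat \<Rightarrow> ('f, 'p, 'u) interp" where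
  "coord \<sigma> n \<equiv> (A n)\<lparr>assignment := \<lambda>x. \<sigma> x n\<rparr>"

abbreviation quot :: "(nat \<Rightarrow> nat \<Rightarrow> 'u) \<Rightarrow> ('f, 'p, 'v) interp" where
  "quot \<sigma> \<equiv> model\<lparr>assignment := \<lambda>x. h (\<sigma> x)\<rparr>"

lemma rep_in: "u \<in> h ` S \<Longrightarrow> rep u \<in> S"
  by (simp add: rep_def inv_into_into)

lemma h_rep: "u \<in> h ` S \<Longrightarrow> h (rep u) = u"
  by (simp add: rep_def f_inv_into_f)

lemma eventually_rep_h: "g \<in> S \<Longrightarrow> eventually (\<lambda>n. rep (h g) n = g n) U"
  using h_eq_iff[of "rep (h g)" g] rep_in[of "h g"] h_rep[of "h g"] by auto

text \<open>A list has finitely many entries, and finitely many statements that each hold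
  \<open>U\<close>-almost everywhere hold jointly so.\<close>

lemma eventually_map_rep_h:
  assumes "set gs \<subseteq> S"
  shows "eventually (\<lambda>n. map (\<lambda>u. rep u n) (map h gs) = map (\<lambda>g. g n) gs) U"
proof -
  have "eventually (\<lambda>n. \<forall>g\<in>set gs. rep (h g) n = g n) U"
    using assms eventually_rep_h by (subst eventually_ball_finite_distrib) auto
  then show ?thesis
    by (rule eventually_mono) simp
qed

lemma eventually_not_iff: "eventually (\<lambda>n. \<not> P n) U \<longleftrightarrow> \<not> eventually P U"
proof
  assume "eventually (\<lambda>n. \<not> P n) U"
  then show "\<not> eventually P U"
    using U_proper eventually_elim2[of P U "\<lambda>n. \<not> P n" "\<lambda>_. False"]
    by (auto simp: trivial_limit_def)
qed (rule U_ultra)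

text \<open>By De Morgan this reduces to negation, where the ultrafilter property enters, and
  conjunction.\<close>

lemma eventually_or_iff:
  "eventually (\<lambda>n. P n \<or> Q n) U \<longleftrightarrow> eventually P U \<or> eventually Q U"
  using eventually_not_iff[of "\<lambda>n. P n \<or> Q n"] eventually_not_iff[of P] eventually_not_iff[of Q]
  by (auto simp: eventually_conj_iff)

text \<open>Closure under function symbols is a case of closure under witnesses: the equation
  between a fresh variable and \<open>f\<close> applied to the arguments has exactly one solution in
  each coordinate.\<close>

lemma S_closed_fun:
  assumes "f \<in> funs \<Sigma>" "length gs = farity \<Sigma> f" "set gs \<subseteq> S"
  shows "(\<lambda>n. fun_int (A n) f (map (\<lambda>g. g n) gs)) \<in> S"
proof -
  let ?m = "length gs"
  \<comment> \<open>The default past the arguments is a member of \<open>S\<close>, so that the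
    whole range of \<sigma> lies in \<open>S\<close>. Variable \<open>?m\<close> is the fresh
    one.\<close>
  define \<sigma> where "\<sigma> y = (if y < ?m then gs ! y else (\<lambda>n. assignment (A n) 0))" for y
  define \<psi> :: "('f, 'p) fm" where "\<psi> = Eq (Var ?m) (Fn f (map Var [0..<?m]))"
  have "range \<sigma> \<subseteq> S"
    using assms(3) S_assignment by (auto simp: \<sigma>_def)
  moreover have "fm_over \<Sigma> \<psi>"
    using assms by (auto simp: \<psi>_def)
  ultimately obtain g where "g \<in> S" and g: "\<And>n.
      (\<exists>a\<in>domain (A n). sat ((A n)\<lparr>assignment := (\<lambda>y. \<sigma> y n)(?m := a)\<rparr>) \<psi>)
         \<Longrightarrow> sat ((A n)\<lparr>assignment := (\<lambda>y. \<sigma> y n)(?m := g n)\<rparr>) \<psi>"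
    using S_witness[of \<psi> \<sigma> ?m] by blast
  have sat: "sat ((A n)\<lparr>assignment := (\<lambda>y. \<sigma> y n)(?m := a)\<rparr>) \<psi>
      \<longleftrightarrow> a = fun_int (A n) f (map (\<lambda>g. g n) gs)" for n a
  proof -
    have "map (tm_val ((A n)\<lparr>assignment := (\<lambda>y. \<sigma> y n)(?m := a)\<rparr>)) (map Var [0..<?m])
        = map (\<lambda>g. g n) gs"
      by (rule nth_equalityI) (auto simp: \<sigma>_def)
    then show ?thesis by (simp add: \<psi>_def del: map_map)
  qed
  have "fun_int (A n) f (map (\<lambda>g. g n) gs) \<in> domain (A n)" for n
  proof -
    have "set (map (\<lambda>g. g n) gs) \<subseteq> domain (A n)"
      using assms(3) S_domain by auto
    then show ?thesis
      using interp[of n] assms(1,2) unfolding is_interp_def by (metis length_map)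
  qed
  \<comment> \<open>The solution exists in the domain of every \<open>A n\<close> and is unique, so
    the Skolem witness is forced.\<close>
  then have "g = (\<lambda>n. fun_int (A n) f (map (\<lambda>g. g n) gs))"
    using g unfolding sat by blast
  with \<open>g \<in> S\<close> show ?thesis by simp
qed

lemma is_interp_model: "is_interp \<Sigma> model"
  unfolding is_interp_def
proof (intro conjI ballI allI impI)
  show "domain model \<noteq> {}"
    using S_assignment by (auto simp: model_def)
  show "assignment model x \<in> domain model" for x
    using S_assignment by (auto simp: model_def)
  fix f us assume f: "f \<in> funs \<Sigma>" and us: "length us = farity \<Sigma> f \<and> set us \<subseteq> domain model"
  have "(\<lambda>n. fun_int (A n) f (map (\<lambda>g. g n) (map rep us))) \<in> S"
    using f us by (intro S_closed_fun) (auto simp: model_def intro!: rep_in)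
  then show "fun_int model f us \<in> domain model"
    by (simp add: model_def comp_def)
qed

text \<open>Membership in \<open>S\<close> is carried through the induction because both
  \<open>S_closed_fun\<close> and \<open>h_eq_iff\<close> require it of the arguments.\<close>

lemma tm_val_quot:
  assumes "tm_over \<Sigma> t" "range \<sigma> \<subseteq> S"
  shows "(\<lambda>n. tm_val (coord \<sigma> n) t) \<in> S \<and> tm_val (quot \<sigma>) t = h (\<lambda>n. tm_val (coord \<sigma> n) t)"
  using assms(1)
proof (induction t)
  case (Var x)
  then show ?case using assms(2) by auto
next
  case (Fn f ts)
  define gs where "gs = map (\<lambda>t n. tm_val (coord \<sigma> n) t) ts"
  have gs: "set gs \<subseteq> S" "length gs = farity \<Sigma> f" "f \<in> funs \<Sigma>"
    using Fn by (auto simp: gs_def)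
  have vals: "map (tm_val (quot \<sigma>)) ts = map h gs"
    using Fn by (auto simp: gs_def)
  have coord: "(\<lambda>n. tm_val (coord \<sigma> n) (Fn f ts)) = (\<lambda>n. fun_int (A n) f (map (\<lambda>g. g n) gs))"
    by (simp add: gs_def comp_def)
  \<comment> \<open>\<open>h_eq_iff\<close> compares members of \<open>S\<close> only, so the value
    on representatives and the value on the original arguments are both placed in \<open>S\<close>
    first.\<close>
  have "(\<lambda>n. fun_int (A n) f (map (\<lambda>g. g n) (map rep (map h gs)))) \<in> S"
    using gs by (intro S_closed_fun) (auto intro!: rep_in)
  then have "(\<lambda>n. fun_int (A n) f (map (\<lambda>u. rep u n) (map h gs))) \<in> S"
    by (simp add: comp_def)
  moreover have "(\<lambda>n. fun_int (A n) f (map (\<lambda>g. g n) gs)) \<in> S"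
    using gs by (intro S_closed_fun)
  moreover have "eventually (\<lambda>n. fun_int (A n) f (map (\<lambda>u. rep u n) (map h gs)) =
      fun_int (A n) f (map (\<lambda>g. g n) gs)) U"
    using eventually_map_rep_h[OF gs(1)] by (rule eventually_mono) (simp del: map_map)
  ultimately have "h (\<lambda>n. fun_int (A n) f (map (\<lambda>u. rep u n) (map h gs))) =
      h (\<lambda>n. fun_int (A n) f (map (\<lambda>g. g n) gs))"
    by (simp only: h_eq_iff)
  moreover have "tm_val (quot \<sigma>) (Fn f ts) =
      h (\<lambda>n. fun_int (A n) f (map (\<lambda>u. rep u n) (map h gs)))"
    by (simp only: tm_val.simps vals) (simp add: model_def)
  ultimately show ?case
    using \<open>(\<lambda>n. fun_int (A n) f (map (\<lambda>g. g n) gs)) \<in> S\<close> unfolding coord by simp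
qed

lemma coord_upd: "(A n)\<lparr>assignment := (\<lambda>y. \<sigma> y n)(x := g n)\<rparr> = coord (\<sigma>(x := g)) n"
proof -
  have "(\<lambda>y. \<sigma> y n)(x := g n) = (\<lambda>y. (\<sigma>(x := g)) y n)" by auto
  then show ?thesis by simp
qed

lemma quot_upd: "model\<lparr>assignment := (\<lambda>y. h (\<sigma> y))(x := h g)\<rparr> = quot (\<sigma>(x := g))"
proof -
  have "(\<lambda>y. h (\<sigma> y))(x := h g) = (\<lambda>y. h ((\<sigma>(x := g)) y))" by auto
  then show ?thesis by simp
qed

text \<open>This is the quantifier step of Los's theorem. From left to right, one Skolem witness
  \<open>g\<close> works in every coordinate that has a witness at all; conversely, the values of
  \<open>g\<close> are witnesses.\<close>

lemma eventually_ex_iff: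
  assumes "fm_over \<Sigma> \<psi>" "range \<sigma> \<subseteq> S"
  shows "eventually (\<lambda>n. \<exists>a\<in>domain (A n). sat ((A n)\<lparr>assignment := (\<lambda>y. \<sigma> y n)(x := a)\<rparr>) \<psi>) U
    \<longleftrightarrow> (\<exists>g\<in>S. eventually (\<lambda>n. sat (coord (\<sigma>(x := g)) n) \<psi>) U)" (is "?L \<longleftrightarrow> ?R")
proof
  assume ?L
  obtain g where "g \<in> S" and g:
    "\<And>n. (\<exists>a\<in>domain (A n). sat ((A n)\<lparr>assignment := (\<lambda>y. \<sigma> y n)(x := a)\<rparr>) \<psi>)
       \<Longrightarrow> sat ((A n)\<lparr>assignment := (\<lambda>y. \<sigma> y n)(x := g n)\<rparr>) \<psi>"
    using S_witness[OF assms, of x] by blast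
  have "eventually (\<lambda>n. sat (coord (\<sigma>(x := g)) n) \<psi>) U"
    using \<open>?L\<close> by (rule eventually_mono) (use g in \<open>simp only: coord_upd\<close>)
  with \<open>g \<in> S\<close> show ?R by blast
next
  assume ?R
  then obtain g where "g \<in> S" and ev: "eventually (\<lambda>n. sat (coord (\<sigma>(x := g)) n) \<psi>) U"
    by blast
  from ev show ?L
  proof (rule eventually_mono)
    fix n assume "sat (coord (\<sigma>(x := g)) n) \<psi>"
    then have "sat ((A n)\<lparr>assignment := (\<lambda>y. \<sigma> y n)(x := g n)\<rparr>) \<psi>"
      by (simp only: coord_upd)
    with S_domain[OF \<open>g \<in> S\<close>]
    show "\<exists>a\<in>domain (A n). sat ((A n)\<lparr>assignment := (\<lambda>y. \<sigma> y n)(x := a)\<rparr>) \<psi>" by blast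
  qed
qed

theorem Los:
  assumes "fm_over \<Sigma> \<psi>" "range \<sigma> \<subseteq> S"
  shows "sat (quot \<sigma>) \<psi> \<longleftrightarrow> eventually (\<lambda>n. sat (coord \<sigma> n) \<psi>) U"
  using assms
proof (induction \<psi> arbitrary: \<sigma>)
  case (Eq s t)
  then show ?case
    using tm_val_quot[of s \<sigma>] tm_val_quot[of t \<sigma>] by (simp add: h_eq_iff)
next
  case (Pred p ts)
  define gs where "gs = map (\<lambda>t n. tm_val (coord \<sigma> n) t) ts"
  have gs: "set gs \<subseteq> S"
    using Pred tm_val_quot by (auto simp: gs_def)
  have vals: "map (tm_val (quot \<sigma>)) ts = map h gs"
    using Pred tm_val_quot by (auto simp: gs_def)
  have "sat (quot \<sigma>) (Pred p ts) \<longleftrightarrow>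
      eventually (\<lambda>n. pred_int (A n) p (map (\<lambda>u. rep u n) (map h gs))) U"
    by (simp only: sat.simps vals) (simp add: model_def)
  also have "\<dots> \<longleftrightarrow> eventually (\<lambda>n. pred_int (A n) p (map (\<lambda>g. g n) gs)) U"
    using eventually_map_rep_h[OF gs]
    by (intro eventually_cong) (auto elim!: eventually_mono simp del: map_map)
  also have "\<dots> \<longleftrightarrow> eventually (\<lambda>n. sat (coord \<sigma> n) (Pred p ts)) U"
    by (simp add: gs_def comp_def)
  finally show ?case .
next
  case (Neg \<psi>)
  then show ?case by (simp add: eventually_not_iff)
next
  case (And \<psi>1 \<psi>2)
  then show ?case by (simp add: eventually_conj_iff)
next
  case (Or \<psi>1 \<psi>2)
  then show ?case by (simp add: eventually_or_iff)
next
  case (Imp \<psi>1 \<psi>2)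
  then show ?case
    by (simp only: sat.simps fm_over.simps imp_conv_disj eventually_or_iff eventually_not_iff)
next
  case (All x \<psi>)
  have IH: "sat (quot (\<sigma>(x := g))) \<psi> \<longleftrightarrow> eventually (\<lambda>n. sat (coord (\<sigma>(x := g)) n) \<psi>) U"
    if "g \<in> S" for g
    using that All.prems by (intro All.IH) auto
  have "sat (quot \<sigma>) (All x \<psi>) \<longleftrightarrow> (\<forall>g\<in>S. sat (quot (\<sigma>(x := g))) \<psi>)"
    by (simp add: quot_upd[symmetric] del: fun_upd_apply) (simp add: model_def)
  \<comment> \<open>The universal quantifier is treated as a negated existential one, so that
    \<open>eventually_ex_iff\<close> applies to \<open>Neg \<psi>\<close>.\<close>
  also have "\<dots> \<longleftrightarrow> \<not> (\<exists>g\<in>S. eventually (\<lambda>n. sat (coord (\<sigma>(x := g)) n) (Neg \<psi>)) U)"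
    by (simp add: IH eventually_not_iff del: fun_upd_apply)
  also have "\<dots> \<longleftrightarrow> eventually (\<lambda>n. sat (coord \<sigma> n) (All x \<psi>)) U"
    using All.prems
    by (subst eventually_ex_iff[symmetric]) (simp_all add: eventually_not_iff[symmetric])
  finally show ?case .
next
  case (Ex x \<psi>)
  have IH: "sat (quot (\<sigma>(x := g))) \<psi> \<longleftrightarrow> eventually (\<lambda>n. sat (coord (\<sigma>(x := g)) n) \<psi>) U"
    if "g \<in> S" for g
    using that Ex.prems by (intro Ex.IH) auto
  have "sat (quot \<sigma>) (Ex x \<psi>) \<longleftrightarrow> (\<exists>g\<in>S. sat (quot (\<sigma>(x := g))) \<psi>)"
    by (simp add: quot_upd[symmetric] del: fun_upd_apply) (simp add: model_def)
  also have "\<dots> \<longleftrightarrow> (\<exists>g\<in>S. eventually (\<lambda>n. sat (coord (\<sigma>(x := g)) n) \<psi>) U)"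
    by (simp add: IH del: fun_upd_apply)
  also have "\<dots> \<longleftrightarrow> eventually (\<lambda>n. sat (coord \<sigma> n) (Ex x \<psi>)) U"
    using Ex.prems by (subst eventually_ex_iff[symmetric]) simp_all
  finally show ?case .
qed

lemma sat_model:
  assumes "fm_over \<Sigma> \<psi>" "\<And>n. sat (A n) \<psi>"
  shows "sat model \<psi>"
proof -
  \<comment> \<open>With the factors' own assignments, \<open>quot\<close> and \<open>coord\<close>
    give back \<open>model\<close> and \<open>A n\<close>, so open formulas transfer as well as
    sentences.\<close>
  let ?\<sigma> = "\<lambda>x n. assignment (A n) x"
  have "quot ?\<sigma> = model" by (simp add: model_def)
  moreover have "coord ?\<sigma> n = A n" for n by simp
  ultimately show ?thesis
    using Los[of \<psi> ?\<sigma>] assms S_assignment by auto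
qed

end

section \<open>Infinite models from arbitrarily large finite ones\<close>

text \<open>The predicate \<open>R x\<close> is itself the class of \<open>x\<close>. The countably
  many classes met by \<open>S\<close> are numbered, and the numbers are injected into
  \<open>'v\<close>.\<close>

lemma ex_countable_quotient_embedding:
  assumes "countable S" "infinite (UNIV :: 'v set)" "equivp R"
  obtains h :: "'a \<Rightarrow> 'v" where "\<And>x y. x \<in> S \<Longrightarrow> y \<in> S \<Longrightarrow> h x = h y \<longleftrightarrow> R x y"
proof -
  obtain j :: "nat \<Rightarrow> 'v" where j: "inj j"
    using infinite_countable_subset[OF assms(2)] by blast
  let ?C = "R ` S"
  have "countable ?C" using assms(1) by simp
  then have "to_nat_on ?C (R x) = to_nat_on ?C (R y) \<longleftrightarrow> R x y" if "x \<in> S" "y \<in> S" for x y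
    using that assms(3) by (simp add: equivp_def)
  then show ?thesis
    using j by (intro that[of "\<lambda>x. j (to_nat_on ?C (R x))"]) (simp add: inj_eq)
qed

text \<open>The hull is started from choice functions \<open>d i\<close> that are pairwise distinct
  in all late coordinates. Their classes are then infinitely many elements of the
  ultraproduct.\<close>

lemma ex_infinite_model:
  fixes \<Sigma> :: "('f, 'p) signature" and T :: "('f, 'p, 'u) interp set"
  assumes "infinite (UNIV :: 'u set)" "countable_signature \<Sigma>" "is_theory \<Sigma> T" "fm_over \<Sigma> \<phi>"
    and large: "\<And>n. \<exists>\<A>\<in>T. finite (domain \<A>) \<and> n < card (domain \<A>) \<and> sat \<A> \<phi>"
  shows "\<exists>\<A>\<in>T. infinite (domain \<A>) \<and> sat \<A> \<phi>"
proof -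
  obtain Ax where Ax: "\<And>\<psi>. \<psi> \<in> Ax \<Longrightarrow> sentence \<Sigma> \<psi>"
    and T: "T = {\<A>. is_interp \<Sigma> \<A> \<and> (\<forall>\<psi> \<in> Ax. sat \<A> \<psi>)}"
    using assms(3) by (auto simp: is_theory_def)
  obtain A where A: "\<And>n. A n \<in> T" "\<And>n. finite (domain (A n))" "\<And>n. n < card (domain (A n))"
      "\<And>n. sat (A n) \<phi>"
    using large by metis
  \<comment> \<open>More than \<open>n\<close> elements leave room for the \<open>n + 1\<close>
    points of \<open>{..n}\<close>.\<close>
  have "\<exists>e. e ` {..n} \<subseteq> domain (A n) \<and> inj_on e {..n}" for n
    using card_le_inj[of "{..n}" "domain (A n)"] A(2,3)[of n] by auto
  then obtain e where e: "\<And>n. e n ` {..n} \<subseteq> domain (A n)" "\<And>n. inj_on (e n) {..n}"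
    by metis
  \<comment> \<open>\<open>min i n\<close> keeps the index in range in the early coordinates; from
    \<open>n = i\<close> on, \<open>d i n\<close> is \<open>e n i\<close>.\<close>
  define d where "d i n = e n (min i n)" for i n
  let ?B = "range d \<union> range (\<lambda>x n. assignment (A n) x)"
  have interp: "is_interp \<Sigma> (A n)" for n
    using A(1) T by auto
  have B_domain: "g n \<in> domain (A n)" if "g \<in> ?B" for g n
  proof -
    have "d i n \<in> domain (A n)" for i
      using e(1)[of n] by (auto simp: d_def)
    then show ?thesis
      using that interp[of n] by (auto simp: is_interp_def)
  qed
  have nonempty: "domain (A n) \<noteq> {}" for n
    using interp[of n] by (simp add: is_interp_def)
  have B: "countable ?B" "?B \<noteq> {}" by auto
  obtain S where S: "countable S" "?B \<subseteq> S" "\<And>g n. g \<in> S \<Longrightarrow> g n \<in> domain (A n)"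
    "\<And>\<psi> x \<sigma>. fm_over \<Sigma> \<psi> \<Longrightarrow> range \<sigma> \<subseteq> S \<Longrightarrow>
       \<exists>g\<in>S. \<forall>n. (\<exists>a\<in>domain (A n). sat ((A n)\<lparr>assignment := (\<lambda>y. \<sigma> y n)(x := a)\<rparr>) \<psi>)
         \<longrightarrow> sat ((A n)\<lparr>assignment := (\<lambda>y. \<sigma> y n)(x := g n)\<rparr>) \<psi>"
    by (rule countable_skolem_hull[where A = A and B = ?B, OF assms(2) nonempty B])
      (erule B_domain, rule that)
  obtain U :: "nat filter" where U: "U \<le> sequentially" "U \<noteq> bot"
    "\<And>P. \<not> eventually P U \<Longrightarrow> eventually (\<lambda>x. \<not> P x) U"
    using ex_ultrafilter_le[OF sequentially_bot] by metis
  have equiv: "equivp (\<lambda>g g'. eventually (\<lambda>n. g n = (g' n :: 'u)) U)"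
  proof (rule equivpI)
    show "reflp (\<lambda>g g'. eventually (\<lambda>n. g n = (g' n :: 'u)) U)"
      by (simp add: reflp_def)
    show "symp (\<lambda>g g'. eventually (\<lambda>n. g n = (g' n :: 'u)) U)"
      by (simp add: symp_def eq_commute)
    show "transp (\<lambda>g g'. eventually (\<lambda>n. g n = (g' n :: 'u)) U)"
      by (auto simp: transp_def elim: eventually_elim2)
  qed
  obtain h :: "(nat \<Rightarrow> 'u) \<Rightarrow> 'u" where
    h: "\<And>g g'. g \<in> S \<Longrightarrow> g' \<in> S \<Longrightarrow> h g = h g' \<longleftrightarrow> eventually (\<lambda>n. g n = g' n) U"
    by (rule ex_countable_quotient_embedding[OF S(1) assms(1) equiv]) (rule that)
  interpret skolem_ultraproduct \<Sigma> A U S h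
    using interp U S h by unfold_locales auto
  have "inj (\<lambda>i. h (d i))"
  proof (rule injI)
    fix i j assume "h (d i) = h (d j)"
    then have "eventually (\<lambda>n. d i n = d j n) U"
      using h[of "d i" "d j"] S(2) by auto
    \<comment> \<open>Since \<open>U\<close> refines \<open>sequentially\<close>, the finitely many
      coordinates where \<open>d i\<close> and \<open>d j\<close> may be truncated can be
      discarded.\<close>
    moreover have "eventually (\<lambda>n. max i j \<le> n) U"
      using U(1) eventually_ge_at_top filter_leD by blast
    ultimately have "eventually (\<lambda>n. i = j) U"
    proof (rule eventually_elim2)
      fix n assume "d i n = d j n" "max i j \<le> n"
      then show "i = j"
        using inj_onD[OF e(2)[of n], of i j] by (simp add: d_def min_absorb1)
    qed
    then show "i = j" using U(2) by auto
  qed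
  moreover have "range (\<lambda>i. h (d i)) \<subseteq> domain model"
    using S(2) by (auto simp: model_def)
  ultimately have "infinite (domain model)"
    using finite_subset range_inj_infinite by blast
  moreover have "model \<in> T"
    using is_interp_model Ax A(1) by (auto simp: T sentence_def intro!: sat_model)
  ultimately show ?thesis
    using sat_model[OF assms(4) A(4)] by blast
qed

section \<open>Positive density and large finite models\<close>

text \<open>The counts for a finite spectrum are bounded by a constant, and dividing by
  \<open>n\<close> squeezes the density to 0.\<close>

lemma infinite_Spec_if_positive_density:
  assumes "\<mu>_defined T \<phi>" "\<mu> T \<phi> > 0"
  shows "infinite (Spec T \<phi>)"
proof
  assume fin: "finite (Spec T \<phi>)"
  have "(\<lambda>n. real (card (Spec T \<phi>)) / real n) \<longlonglongrightarrow> 0"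
    by (rule lim_const_over_n)
  then have "density_seq T \<phi> \<longlonglongrightarrow> 0"
  proof (rule tendsto_sandwich[OF _ _ tendsto_const, rotated 2])
    show "\<forall>\<^sub>F n in sequentially. 0 \<le> density_seq T \<phi> n"
      by (simp add: density_seq_def)
    show "\<forall>\<^sub>F n in sequentially. density_seq T \<phi> n \<le> real (card (Spec T \<phi>)) / real n"
      unfolding density_seq_def Spec_upto_def using fin
      by (intro always_eventually allI divide_right_mono of_nat_mono card_mono) auto
  qed
  then have "\<mu> T \<phi> = 0"
    unfolding \<mu>_def by (rule limI)
  with assms show False by simp
qed

theorem theorem7:
  fixes \<Sigma> :: "('f, 'p) signature"
    and T :: "('f, 'p, 'u) interp set"
  assumes "infinite (UNIV :: 'u set)"
    and "countable_signature \<Sigma>"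
    and "is_theory \<Sigma> T"
    and "\<And>\<phi>. qf_formula \<Sigma> \<phi> \<Longrightarrow> satisfiable_in T \<phi> \<Longrightarrow> \<mu>_defined T \<phi> \<and> \<mu> T \<phi> > 0"
  shows "stably_infinite \<Sigma> T \<and> finite_model_property \<Sigma> T"
proof -
  \<comment> \<open>An infinite set of cardinalities is unbounded. This one fact yields both
    conclusions: any single \<open>n\<close> gives a finite model, and all \<open>n\<close> together
    feed the ultraproduct.\<close>
  have large: "\<exists>\<A>\<in>T. finite (domain \<A>) \<and> n < card (domain \<A>) \<and> sat \<A> \<phi>"
    if "qf_formula \<Sigma> \<phi>" "satisfiable_in T \<phi>" for \<phi> n
  proof -
    have "infinite (Spec T \<phi>)"
      using assms(4)[OF that] infinite_Spec_if_positive_density by blast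
    then obtain m where "n < m" "m \<in> Spec T \<phi>"
      using infinite_nat_iff_unbounded by blast
    then show ?thesis by (auto simp: Spec_def)
  qed
  show ?thesis
    unfolding stably_infinite_def finite_model_property_def
  proof (intro conjI allI impI)
    fix \<phi> assume \<phi>: "qf_formula \<Sigma> \<phi> \<and> satisfiable_in T \<phi>"
    then show "\<exists>\<A>\<in>T. infinite (domain \<A>) \<and> sat \<A> \<phi>"
      using assms large by (intro ex_infinite_model) (auto simp: qf_formula_def)
    from \<phi> show "\<exists>\<A>\<in>T. finite (domain \<A>) \<and> sat \<A> \<phi>"
      using large by blast
  qed
qed

end
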